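(* Let $R=\mathbb{C}[\partial]A\oplus\mathbb{C}[\partial]B$ be a rank two Lie conformal algebra satisfying $[A_\lambda A]=[B_\lambda A]=0$ and $[B_\lambda B]=(2\lambda+\partial)B+Q(\lambda,\partial)A$ for some $Q(\lambda,\partial)\in\mathbb{C}[\lambda,\partial]$. Then by a suitable change of basis we can set $Q(\lambda,\partial)=0$; that is, there is a basis $\{A,B'\}$ of $R$ with $[A_\lambda A]=[B'_\lambda A]=0$ and $[B'_\lambda B']=(2\lambda+\partial)B'$.
   Context: All vector spaces are over $\mathbb{C}$. A Lie conformal algebra is a $\mathbb{C}[\partial]$-module $R$ with a $\mathbb{C}$-linear map $R\otimes R\to\mathbb{C}[\lambda]\otimes R$, $a\otimes b\mapsto[a_\lambda b]$, such that for all $a,b,c\in R$: $[\partial a_\lambda b]=-\lambda[a_\lambda b]$ and $[a_\lambda\partial b]=(\lambda+\partial)[a_\lambda b]$; $[b_\lambda a]=-[a_{-\lambda-\partial}b]$; $[a_\lambda[b_\mu c]]-[b_\mu[a_\lambda c]]=[[a_\lambda b]_{\lambda+\mu}c]$. It has rank two if it is free of rank two as a $\mathbb{C}[\partial]$-module; a basis means a $\mathbb{C}[\partial]$-basis. *)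

theory Defs
  imports Complex_Main "HOL-Computational_Algebra.Polynomial"
begin

text \<open>
  A \<open>\<complex>[\<partial>]\<close>-module is a module \<^term>\<open>scale :: complex poly \<Rightarrow> 'r \<Rightarrow> 'r\<close> on a type \<open>'r\<close>; its complex vector
  space structure is the action of the constant polynomials. An element
  \<open>\<Sum>\<^sub>n \<lambda>\<^sup>n v\<^sub>n\<close> of \<open>\<complex>[\<lambda>] \<otimes> R\<close> is the \<^typ>\<open>'r poly\<close> with coefficients \<open>v\<^sub>n\<close>, so multiplication by \<open>\<lambda>\<close>
  is \<^term>\<open>pCons 0\<close>, and an element of \<open>\<complex>[\<lambda>,\<mu>] \<otimes> R\<close> is an \<^typ>\<open>'r poly poly\<close>.
  In the scalar rings \<open>\<complex>[\<lambda>,\<partial>]\<close> and \<open>\<complex>[\<lambda>,\<mu>]\<close>, both of type \<^typ>\<open>complex poly poly\<close>,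
  the variable \<open>\<lambda>\<close> is always the outer one.
\<close>

definition D :: "complex poly" where
  "D = [:0, 1:]"

definition lam :: "complex poly poly" where
  "lam = [:0, 1:]"

definition del :: "complex poly poly" where
  "del = [:D:]"

definition mu :: "complex poly poly" where
  "mu = [:[:0, 1:]:]"

text \<open>\<open>P(\<lambda>,\<partial>) v \<in> \<complex>[\<lambda>] \<otimes> R\<close> for \<open>P \<in> \<complex>[\<lambda>,\<partial>]\<close> and \<open>v \<in> R\<close>.\<close>

definition act_lam_del ::
  "(complex poly \<Rightarrow> 'r::ab_group_add \<Rightarrow> 'r) \<Rightarrow> complex poly poly \<Rightarrow> 'r \<Rightarrow> 'r poly" where
  "act_lam_del scale P v = map_poly (\<lambda>p. scale p v) P"

text \<open>\<open>P(\<lambda>,\<mu>) \<otimes> v \<in> \<complex>[\<lambda>,\<mu>] \<otimes> R\<close> for \<open>P \<in> \<complex>[\<lambda>,\<mu>]\<close> and \<open>v \<in> R\<close>.\<close>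

definition act_lam_mu ::
  "(complex poly \<Rightarrow> 'r::ab_group_add \<Rightarrow> 'r) \<Rightarrow> complex poly poly \<Rightarrow> 'r \<Rightarrow> 'r poly poly" where
  "act_lam_mu scale P v = map_poly (map_poly (\<lambda>c. scale [:c:] v)) P"

text \<open>\<open>f(X) = \<Sum>\<^sub>n X\<^sup>n v\<^sub>n\<close> for \<open>f = \<Sum>\<^sub>n \<lambda>\<^sup>n v\<^sub>n\<close> and \<open>X \<in> \<complex>[\<lambda>,\<partial>]\<close>; the powers of \<open>\<partial>\<close> in \<open>X\<^sup>n\<close> act on \<open>v\<^sub>n\<close>.\<close>

definition subst_lam_del ::
  "(complex poly \<Rightarrow> 'r::ab_group_add \<Rightarrow> 'r) \<Rightarrow> complex poly poly \<Rightarrow> 'r poly \<Rightarrow> 'r poly" where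
  "subst_lam_del scale X f = (\<Sum>n\<le>degree f. act_lam_del scale (X ^ n) (coeff f n))"

text \<open>
  Nested brackets: \<open>\<Sum>\<^sub>n X\<^sup>n F(v\<^sub>n)(Y)\<close> for \<open>f = \<Sum>\<^sub>n \<lambda>\<^sup>n v\<^sub>n\<close>, \<open>F : R \<rightarrow> \<complex>[\<lambda>] \<otimes> R\<close> and \<open>X, Y \<in> \<complex>[\<lambda>,\<mu>]\<close>.
  That is, the variable of the inner bracket \<open>f\<close> is set to \<open>X\<close>, and the variable of the
  outer bracket \<open>F\<close> is set to \<open>Y\<close>.
\<close>

definition nest ::
  "(complex poly \<Rightarrow> 'r::ab_group_add \<Rightarrow> 'r) \<Rightarrow> complex poly poly \<Rightarrow> complex poly poly \<Rightarrow>
    'r poly \<Rightarrow> ('r \<Rightarrow> 'r poly) \<Rightarrow> 'r poly poly" where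
  "nest scale X Y f F =
    (\<Sum>n\<le>degree f. \<Sum>m\<le>degree (F (coeff f n)).
      act_lam_mu scale (X ^ n * Y ^ m) (coeff (F (coeff f n)) m))"

locale lie_conformal_algebra = module scale
  for scale :: "complex poly \<Rightarrow> 'r::ab_group_add \<Rightarrow> 'r" +
  fixes bracket :: "'r \<Rightarrow> 'r \<Rightarrow> 'r poly"
  assumes bracket_add_left: "bracket (a + b) c = bracket a c + bracket b c"
    and bracket_add_right: "bracket a (b + c) = bracket a b + bracket a c"
    and bracket_scale_left: "bracket (scale [:z:] a) b = map_poly (scale [:z:]) (bracket a b)"
    and bracket_scale_right: "bracket a (scale [:z:] b) = map_poly (scale [:z:]) (bracket a b)"
    and sesquilinear_left: "bracket (scale D a) b = - pCons 0 (bracket a b)"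
    and sesquilinear_right:
      "bracket a (scale D b) = pCons 0 (bracket a b) + map_poly (scale D) (bracket a b)"
    and skew_symmetry: "bracket b a = - subst_lam_del scale (- lam - del) (bracket a b)"
    and jacobi:
      "nest scale mu lam (bracket b c) (bracket a) - nest scale lam mu (bracket a c) (bracket b)
        = nest scale lam (lam + mu) (bracket a b) (\<lambda>x. bracket x c)"

definition basis_pair ::
  "(complex poly \<Rightarrow> 'r::ab_group_add \<Rightarrow> 'r) \<Rightarrow> 'r \<Rightarrow> 'r \<Rightarrow> bool" where
  "basis_pair scale A B \<longleftrightarrow>
    A \<noteq> B \<and> \<not> module.dependent scale {A, B} \<and> module.span scale {A, B} = UNIV"

end

theory Submission imports Defs begin

text \<open>
  The Jacobi identity for \<open>B, B, B\<close>, read at \<open>\<mu> = 0\<close>, already forces the shape of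
  \<open>f = [B\<^sub>\<lambda> B] = \<Sum>\<^sub>n \<lambda>\<^sup>n f\<^sub>n\<close>. The right-hand side of the identity becomes \<open>\<lambda> f\<close>, because the
  multiples of \<open>A\<close> in \<open>f\<close> bracket to zero with \<open>B\<close>, while \<open>\<partial>B\<close> and \<open>2\<lambda>B\<close> contribute \<open>-\<lambda> f\<close> and
  \<open>2\<lambda> f\<close>. On the left, \<open>[B\<^sub>\<lambda> f\<^sub>0]\<close> is \<open>(\<lambda> + \<partial>) f\<close>, and the subtracted term is \<open>(\<partial> + 2\<lambda>) f\<^sub>0\<close>
  because \<open>[B\<^sub>\<mu> B]\<close> is \<open>f\<^sub>0\<close> at \<open>\<mu> = 0\<close>. What remains is \<open>\<partial> f = (\<partial> + 2\<lambda>) f\<^sub>0\<close>, that is,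
  \<open>\<partial> f\<^sub>1 = 2 f\<^sub>0\<close> and \<open>\<partial> f\<^sub>n = 0\<close> for \<open>n \<ge> 2\<close>. The lemmas \<open>jacobi_at_mu_zero\<close> and
  \<open>derivation_coeff_bracket\<close> carry this step.

  For \<open>n \<ge> 2\<close> the coefficient \<open>f\<^sub>n\<close> is a multiple of the free generator \<open>A\<close>, so it vanishes. Hence
  \<open>B' = f\<^sub>1 / 2\<close> satisfies \<open>f = \<partial>B' + 2\<lambda>B' = (2\<lambda> + \<partial>)B'\<close>. Moreover
  \<open>B' = B + (q\<^sub>1/2) A\<close>, where \<open>q\<^sub>1(\<partial>)\<close> is the coefficient of \<open>\<lambda>\<close> in \<open>Q\<close>. So \<open>A, B'\<close> is
  again a basis, and \<open>[B'\<^sub>\<lambda> B'] = [B\<^sub>\<lambda> B]\<close> because \<open>\<complex>[\<partial>]A\<close> brackets to zero with \<open>A\<close> and \<open>B\<close>.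
\<close>

section \<open>Coefficients of polynomial actions\<close>

lemma coeff_lam_mult: "coeff (lam * P) k = (case k of 0 \<Rightarrow> 0 | Suc j \<Rightarrow> coeff P j)"
  by (simp add: lam_def coeff_pCons)

lemma coeff_mu_mult: "coeff (coeff (mu * P) k) 0 = 0"
  by (simp add: mu_def)

lemma coeff_lam_power: "coeff (lam ^ n) k = (if k = n then 1 else 0)"
  by (induction n arbitrary: k)
    (auto simp: coeff_lam_mult split: nat.splits)

lemma coeff_mu_power_lam_power:
  "coeff (coeff (mu ^ n * lam ^ m) k) 0 = (if n = 0 \<and> k = m then 1 else 0)"
proof (cases n)
  case 0
  then show ?thesis by (simp add: coeff_lam_power)
next
  case (Suc j)
  then show ?thesis by (simp only: power_Suc mult.assoc coeff_mu_mult) simp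
qed

text \<open>
  Every summand of \<open>(\<lambda> + \<mu>)\<^sup>m\<close> other than \<open>\<lambda>\<^sup>m\<close> is divisible by \<open>\<mu>\<close>. Splitting off one factor
  at a time replaces the binomial expansion.
\<close>

lemma coeff_lam_power_lam_plus_mu_power:
  "coeff (coeff (lam ^ n * (lam + mu) ^ m) k) 0 = (if k = n + m then 1 else 0)"
proof (induction m arbitrary: k)
  case 0
  show ?case by (simp add: coeff_lam_power)
next
  case (Suc m)
  have "lam ^ n * (lam + mu) ^ Suc m
      = lam * (lam ^ n * (lam + mu) ^ m) + mu * (lam ^ n * (lam + mu) ^ m)"
    by (simp add: algebra_simps)
  then show ?case
    by (auto simp: coeff_lam_mult coeff_mu_mult Suc.IH simp del: power_Suc split: nat.splits)
qed

lemma coeff_two_lam_plus_del: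
  "coeff (2 * lam + del) k = (if k = 0 then D else if k = 1 then [:2:] else 0)"
proof -
  have "2 * lam + del = [:D, [:2:]:]"
    by (simp add: lam_def del_def numeral_poly)
  then show ?thesis by (simp add: coeff_pCons split: nat.splits)
qed

context lie_conformal_algebra
begin

lemma coeff_act_lam_del: "coeff (act_lam_del scale P v) k = scale (coeff P k) v"
  by (simp add: act_lam_del_def coeff_map_poly)

lemma coeff_leading_term_plus_multiple:
  "coeff (act_lam_del scale (2 * lam + del) B + act_lam_del scale Q A) n =
    scale (if n = 0 then D else if n = 1 then [:2:] else 0) B + scale (coeff Q n) A"
  by (simp only: coeff_add[of "act_lam_del _ _ _"] coeff_act_lam_del coeff_two_lam_plus_del)

lemma coeff_act_lam_mu:
  "coeff (coeff (act_lam_mu scale P v) k) l = scale [:coeff (coeff P k) l:] v"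
  by (simp add: act_lam_mu_def coeff_map_poly)

section \<open>The Jacobi identity at \<open>\<mu> = 0\<close>\<close>

lemma scale_indicator: "scale [:if P then 1 else 0:] v = (if P then v else 0)"
  by (simp flip: one_pCons)

text \<open>
  The outer variable is \<open>\<lambda>\<close> and the inner one \<open>\<mu>\<close>, so taking the inner coefficient at \<open>0\<close> sets
  \<open>\<mu> = 0\<close>. Each of the three nested brackets then becomes a polynomial in \<open>\<lambda>\<close> alone.
\<close>

lemma coeff_nest:
  "coeff (coeff (nest scale X Y f F) k) 0 =
    (\<Sum>n\<le>degree f. \<Sum>m\<le>degree (F (coeff f n)).
      scale [:coeff (coeff (X ^ n * Y ^ m) k) 0:] (coeff (F (coeff f n)) m))"
  by (simp add: nest_def coeff_sum coeff_act_lam_mu)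

lemma nest_mu_lam_at_mu_zero:
  "coeff (coeff (nest scale mu lam f F) k) 0 = coeff (F (coeff f 0)) k"
proof -
  have "coeff (coeff (nest scale mu lam f F) k) 0 =
    (\<Sum>n\<le>degree f. if n = 0 then \<Sum>m\<le>degree (F (coeff f 0)).
      if k = m then coeff (F (coeff f 0)) m else 0 else 0)"
    unfolding coeff_nest coeff_mu_power_lam_power scale_indicator
    by (intro sum.cong refl) auto
  also have "\<dots> = coeff (F (coeff f 0)) k"
    by (simp add: coeff_eq_0)
  finally show ?thesis .
qed

text \<open>
  \<open>F 0 = 0\<close> covers the indices \<open>k\<close> beyond the degree of \<open>f\<close>, which the sum in \<open>nest\<close> does not
  reach. It serves the same purpose for the substitution \<open>\<lambda> + \<mu>\<close>.
\<close>

lemma nest_lam_mu_at_mu_zero: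
  assumes "F 0 = 0"
  shows "coeff (coeff (nest scale lam mu f F) k) 0 = coeff (F (coeff f k)) 0"
proof -
  have "coeff (coeff (nest scale lam mu f F) k) 0 =
    (\<Sum>n\<le>degree f. if k = n then \<Sum>m\<le>degree (F (coeff f n)).
      if m = 0 then coeff (F (coeff f n)) m else 0 else 0)"
    unfolding coeff_nest mult.commute[of "lam ^ _"] coeff_mu_power_lam_power scale_indicator
    by (intro sum.cong refl) auto
  also have "\<dots> = coeff (F (coeff f k)) 0"
    using assms by (simp add: coeff_eq_0)
  finally show ?thesis .
qed

lemma nest_lam_sum_at_mu_zero:
  assumes "F 0 = 0"
  shows "coeff (coeff (nest scale lam (lam + mu) f F) k) 0
    = (\<Sum>n\<le>k. coeff (F (coeff f n)) (k - n))"
proof -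
  have inner: "(\<Sum>m\<le>degree g. scale [:if k = n + m then 1 else 0:] (coeff g m))
      = (if n \<le> k then coeff g (k - n) else 0)" for g :: "'r poly" and n
  proof -
    have "(\<Sum>m\<le>degree g. scale [:if k = n + m then 1 else 0:] (coeff g m))
        = (\<Sum>m\<le>degree g. if n \<le> k \<and> m = k - n then coeff g m else 0)"
      by (intro sum.cong refl) (auto simp: scale_indicator)
    also have "\<dots> = (if n \<le> k then coeff g (k - n) else 0)"
      by (cases "n \<le> k") (auto simp: coeff_eq_0)
    finally show ?thesis .
  qed
  have "coeff (coeff (nest scale lam (lam + mu) f F) k) 0
      = (\<Sum>n\<le>degree f. if n \<le> k then coeff (F (coeff f n)) (k - n) else 0)"
    unfolding coeff_nest coeff_lam_power_lam_plus_mu_power inner ..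
  also have "\<dots> = (\<Sum>n\<in>{..degree f} \<inter> {..k}. coeff (F (coeff f n)) (k - n))"
    by (simp only: sum.inter_restrict finite_atMost atMost_iff)
  also have "\<dots> = (\<Sum>n\<le>k. coeff (F (coeff f n)) (k - n))"
    using assms by (intro sum.mono_neutral_left) (auto simp: coeff_eq_0 intro!: leI)
  finally show ?thesis .
qed

lemma bracket_zero_left: "bracket 0 c = 0"
  using bracket_add_left[of 0 0 c] by simp

lemma bracket_zero_right: "bracket c 0 = 0"
  using bracket_add_right[of c 0 0] by simp

text \<open>
  At \<open>\<mu> = 0\<close> the inner parameter \<open>\<lambda>\<close> and the outer parameter \<open>\<lambda> + \<mu>\<close> on the right-hand side
  of the Jacobi identity coincide, so its coefficients are convolutions.
\<close>

lemma jacobi_at_mu_zero: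
  "coeff (bracket a (coeff (bracket b c) 0)) k - coeff (bracket b (coeff (bracket a c) k)) 0
    = (\<Sum>n\<le>k. coeff (bracket (coeff (bracket a b) n) c) (k - n))"
  using arg_cong[OF jacobi[of b c a], of "\<lambda>g. coeff (coeff g k) 0"]
  by (simp add: nest_mu_lam_at_mu_zero nest_lam_mu_at_mu_zero nest_lam_sum_at_mu_zero
      bracket_zero_left bracket_zero_right)

section \<open>Elements with zero bracket\<close>

text \<open>
  The axioms give the bracket only under constants and \<open>\<partial>\<close>. Horner's scheme reduces an arbitrary
  polynomial in \<open>\<partial>\<close> to these two cases.
\<close>

lemma scale_pCons: "scale (pCons c p) a = scale [:c:] a + scale D (scale p a)"
proof -
  have "pCons c p = [:c:] + D * p"
    by (simp add: D_def)
  then show ?thesis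
    by (metis scale_left_distrib scale_scale)
qed

lemma bracket_scale_left_eq_0:
  assumes "bracket a b = 0"
  shows "bracket (scale p a) b = 0"
proof (induction p)
  case 0
  show ?case by (simp add: bracket_zero_left)
next
  case (pCons c p)
  then show ?case
    unfolding scale_pCons[of c p]
    by (simp add: assms bracket_add_left bracket_scale_left sesquilinear_left del: scale_scale)
qed

lemma bracket_scale_right_eq_0:
  assumes "bracket b a = 0"
  shows "bracket b (scale p a) = 0"
proof (induction p)
  case 0
  show ?case by (simp add: bracket_zero_right)
next
  case (pCons c p)
  then show ?case
    unfolding scale_pCons[of c p]
    by (simp add: assms bracket_add_right bracket_scale_right sesquilinear_right del: scale_scale)
qed

lemma bracket_eq_0_commute:
  assumes "bracket a b = 0"
  shows "bracket b a = 0"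
  unfolding skew_symmetry[of b a] assms by (simp add: subst_lam_del_def poly_eq_iff coeff_act_lam_del)

section \<open>The bracket of the non-abelian generator\<close>

text \<open>
  At \<open>\<mu> = 0\<close>, with \<open>f = [B\<^sub>\<lambda> B]\<close>, the right-hand side of the Jacobi identity is
  \<open>-\<lambda> f + 2\<lambda> f = \<lambda> f\<close>. It cancels the summand \<open>\<lambda> f\<close> of \<open>[B\<^sub>\<lambda> f\<^sub>0] = (\<lambda> + \<partial>) f\<close> exactly, which
  depends on the leading term \<open>(2\<lambda> + \<partial>)B\<close>. Only \<open>\<partial> f\<close> and the second term on the left remain.
\<close>

lemma derivation_coeff_bracket:
  fixes Q :: "complex poly poly"
  assumes BA: "bracket B A = 0"
    and BB: "bracket B B = act_lam_del scale (2 * lam + del) B + act_lam_del scale Q A"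
  shows "scale D (coeff (bracket B B) (Suc j))
    = coeff (bracket B (coeff (bracket B B) (Suc j))) 0"
proof -
  define f where "f = bracket B B"
  have f_coeff: "coeff f n =
      scale (if n = 0 then D else if n = 1 then [:2:] else 0) B + scale (coeff Q n) A" for n
    unfolding f_def BB by (rule coeff_leading_term_plus_multiple)
  have AB: "bracket A B = 0"
    using BA by (rule bracket_eq_0_commute)
  have "bracket B (coeff f 0) = pCons 0 f + map_poly (scale D) f"
    by (simp add: f_coeff bracket_add_right bracket_scale_right_eq_0[OF BA]
        sesquilinear_right flip: f_def)
  then have left: "coeff (bracket B (coeff f 0)) (Suc j) = coeff f j + scale D (coeff f (Suc j))"
    by (simp add: coeff_map_poly)
  have first: "bracket (coeff f 0) B = - pCons 0 f"
    by (simp add: f_coeff bracket_add_left bracket_scale_left_eq_0[OF AB]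
        sesquilinear_left flip: f_def)
  have second: "bracket (coeff f (Suc 0)) B = map_poly (scale [:2:]) f"
    by (simp add: f_coeff bracket_add_left bracket_scale_left_eq_0[OF AB]
        bracket_scale_left flip: f_def)
  have higher: "bracket (coeff f (Suc (Suc n))) B = 0" for n
    by (simp add: f_coeff bracket_scale_left_eq_0[OF AB])
  have "(\<Sum>n\<le>Suc j. coeff (bracket (coeff f n) B) (Suc j - n))
      = - coeff f j + scale [:2:] (coeff f j)"
    by (cases j)
      (simp_all add: sum.atMost_Suc_shift first second higher coeff_map_poly del: sum.atMost_Suc)
  also have "\<dots> = coeff f j"
  proof -
    have "[:2:] = (1 + 1 :: complex poly)"
      by (simp add: numeral_poly)
    then have "scale [:2:] v = v + v" for v
      by (simp only: scale_left_distrib scale_one)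
    then show ?thesis by simp
  qed
  finally show ?thesis
    using jacobi_at_mu_zero[of B B B "Suc j"] left unfolding f_def[symmetric] by simp
qed

end

section \<open>Change of basis\<close>

text \<open>
  The condition \<open>A \<noteq> B\<close> is absorbed by independence with explicit coefficients: if \<open>A = B\<close>, then
  \<open>1 A + (-1) B = 0\<close> is a nontrivial relation.
\<close>

lemma basis_pair_iff:
  fixes scale :: "complex poly \<Rightarrow> 'r::ab_group_add \<Rightarrow> 'r"
  assumes "module scale"
  shows "basis_pair scale A B \<longleftrightarrow>
    (\<forall>u v. scale u A + scale v B = 0 \<longrightarrow> u = 0 \<and> v = 0) \<and>
    (\<forall>x. \<exists>u v. x = scale u A + scale v B)"
proof -
  interpret module scale by fact
  have "x \<in> span {A, B} \<longleftrightarrow> (\<exists>u v. x = scale u A + scale v B)" for x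
    by (auto simp: span_insert[of A] span_singleton diff_eq_eq add.commute image_iff)
  then have span: "span {A, B} = UNIV \<longleftrightarrow> (\<forall>x. \<exists>u v. x = scale u A + scale v B)"
    by auto
  show ?thesis
  proof (cases "A = B")
    case True
    have "scale 1 A + scale (- 1) B = 0"
      using True by simp
    then have "\<not> (\<forall>u v. scale u A + scale v B = 0 \<longrightarrow> u = 0 \<and> v = 0)"
      by (metis one_neq_zero)
    then show ?thesis
      using True by (simp add: basis_pair_def)
  next
    case False
    have "dependent {A, B} \<longleftrightarrow> (\<exists>w. (w A \<noteq> 0 \<or> w B \<noteq> 0) \<and> scale (w A) A + scale (w B) B = 0)"
      using False by (simp add: dependent_finite)
    also have "\<dots> \<longleftrightarrow> (\<exists>u v. (u \<noteq> 0 \<or> v \<noteq> 0) \<and> scale u A + scale v B = 0)"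
    proof
      assume "\<exists>u v. (u \<noteq> 0 \<or> v \<noteq> 0) \<and> scale u A + scale v B = 0"
      then obtain u v where "u \<noteq> 0 \<or> v \<noteq> 0" "scale u A + scale v B = 0"
        by blast
      then show "\<exists>w. (w A \<noteq> 0 \<or> w B \<noteq> 0) \<and> scale (w A) A + scale (w B) B = 0"
        using False by (intro exI[of _ "\<lambda>x. if x = A then u else v"]) auto
    qed blast
    finally have "\<not> dependent {A, B} \<longleftrightarrow>
        (\<forall>u v. scale u A + scale v B = 0 \<longrightarrow> u = 0 \<and> v = 0)"
      by blast
    then show ?thesis
      using False span by (simp add: basis_pair_def)
  qed
qed

lemma basis_pair_add_scale:
  fixes scale :: "complex poly \<Rightarrow> 'r::ab_group_add \<Rightarrow> 'r"
  assumes "module scale" and basis: "basis_pair scale A B"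
  shows "basis_pair scale A (B + scale p A)"
proof -
  interpret module scale by fact
  have comb: "scale u A + scale v (B + scale p A) = scale (u + v * p) A + scale v B" for u v
    by (simp add: algebra_simps)
  have indep: "u = 0 \<and> v = 0" if "scale u A + scale v (B + scale p A) = 0" for u v
    using that basis unfolding comb basis_pair_iff[OF assms(1)] by fastforce
  have gen: "\<exists>u v. x = scale u A + scale v (B + scale p A)" for x
  proof -
    obtain u v where "x = scale u A + scale v B"
      using basis unfolding basis_pair_iff[OF assms(1)] by blast
    then have "x = scale (u - v * p) A + scale v (B + scale p A)"
      unfolding comb by simp
    then show ?thesis by blast
  qed
  show ?thesis
    unfolding basis_pair_iff[OF assms(1)] using indep gen by blast
qed

theorem proposition2p8:
  fixes scale :: "complex poly \<Rightarrow> 'r::ab_group_add \<Rightarrow> 'r"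
    and bracket :: "'r \<Rightarrow> 'r \<Rightarrow> 'r poly"
    and A B :: 'r
    and Q :: "complex poly poly"
  assumes "lie_conformal_algebra scale bracket"
    and "basis_pair scale A B"
    and "bracket A A = 0"
    and "bracket B A = 0"
    and "bracket B B = act_lam_del scale (2 * lam + del) B + act_lam_del scale Q A"
  shows "\<exists>B'. basis_pair scale A B' \<and>
    bracket A A = 0 \<and> bracket B' A = 0 \<and>
    bracket B' B' = act_lam_del scale (2 * lam + del) B'"
proof -
  interpret lie_conformal_algebra scale bracket by fact
  note AA = assms(3) and BA = assms(4) and BB = assms(5)
  have AB: "bracket A B = 0"
    using BA by (rule bracket_eq_0_commute)
  \<comment> \<open>The factor \<open>1/2\<close> makes \<open>B'\<close> half of the \<open>\<lambda>\<close>-coefficient \<open>2B + q\<^sub>1 A\<close> of \<open>[B\<^sub>\<lambda> B]\<close>.\<close>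
  define p where "p = smult (1/2) (coeff Q 1)"
  define B' where "B' = B + scale p A"
  define f where "f = bracket B B"
  have f_coeff: "coeff f n =
      scale (if n = 0 then D else if n = 1 then [:2:] else 0) B + scale (coeff Q n) A" for n
    unfolding f_def BB by (rule coeff_leading_term_plus_multiple)
  have D_f: "scale D (coeff f (Suc j)) = coeff (bracket B (coeff f (Suc j))) 0" for j
    unfolding f_def by (rule derivation_coeff_bracket[OF BA BB])
  have basis': "basis_pair scale A B'"
    unfolding B'_def using module_axioms assms(2) by (rule basis_pair_add_scale)
  have f1: "coeff f 1 = scale [:2:] B'"
    by (simp add: f_coeff B'_def p_def scale_right_distrib)
  have f0: "coeff f 0 = scale D B'"
  proof -
    have "bracket B (coeff f (Suc 0)) = map_poly (scale [:2:]) f"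
      by (simp add: f_coeff bracket_add_right bracket_scale_right_eq_0[OF BA]
          bracket_scale_right flip: f_def)
    then have "scale [:2:] (coeff f 0) = scale D (scale [:2:] B')"
      using D_f[of 0] f1 by (simp add: coeff_map_poly)
    then have "scale [:1/2:] (scale [:2:] (coeff f 0)) = scale [:1/2:] (scale D (scale [:2:] B'))"
      by simp
    then show ?thesis
      by (simp flip: one_pCons)
  qed
  \<comment> \<open>Here \<open>\<partial>\<close> annihilates a multiple of the free generator \<open>A\<close>.\<close>
  have f_higher: "coeff f (Suc (Suc n)) = 0" for n
  proof -
    have f_eq: "coeff f (Suc (Suc n)) = scale (coeff Q (Suc (Suc n))) A"
      by (simp add: f_coeff)
    then have "scale (D * coeff Q (Suc (Suc n))) A + scale 0 B = 0"
      using D_f[of "Suc n"] by (simp add: bracket_scale_right_eq_0[OF BA])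
    then have "D * coeff Q (Suc (Suc n)) = 0"
      using assms(2) unfolding basis_pair_iff[OF module_axioms] by blast
    then show ?thesis
      by (simp add: f_eq D_def)
  qed
  have "bracket B' A = 0"
    by (simp add: B'_def bracket_add_left BA bracket_scale_left_eq_0[OF AA])
  moreover have "bracket B' B' = f"
    by (simp add: B'_def f_def bracket_add_left bracket_add_right
        bracket_scale_left_eq_0 bracket_scale_right_eq_0 AA AB BA)
  moreover have "f = act_lam_del scale (2 * lam + del) B'"
  proof (rule poly_eqI)
    fix n
    consider "n = 0" | "n = 1" | m where "n = Suc (Suc m)"
      by (metis One_nat_def not0_implies_Suc)
    then show "coeff f n = coeff (act_lam_del scale (2 * lam + del) B') n"
      using f0 f1 f_higher
      by cases (simp_all add: coeff_act_lam_del coeff_two_lam_plus_del del: coeff_add)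
  qed
  ultimately show ?thesis
    using basis' AA by auto
qed

end
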